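(* Let $Z$ be a non-trivial real locally convex linear space, $C \subseteq Z$ a convex cone with $0 \in C$, and $\mathcal A \subseteq \mathcal G(Z, C)$. Then: (a) A set $\mathcal B \subseteq \mathcal A$ generates the infimum of $\mathcal A$ if, and only if, $\sigma^{\vartriangle}_{\inf \mathcal B} = \sigma^{\vartriangle}_{\inf \mathcal A}$ as functions on $C^+$. (b) $\bar A \in \mathcal A$ is minimal for $\mathcal A$ if, and only if, $\sigma^{\vartriangle}_{\bar A}$ is a minimal element of $\{\sigma^{\vartriangle}_A \mid A \in \mathcal A\}$ with respect to the pointwise order of functions $C^+ \to \mathbb R\cup\{\pm\infty\}$.
   Context: $Z^*$ is the topological dual, $C^+ = \{z^* \in Z^* \mid \forall z \in C\colon z^*(z)\ge 0\}$. $\mathcal G(Z,C) = \{A \subseteq Z \mid A = \operatorname{cl}\operatorname{co}(A+C)\}$ (containing $\emptyset$ and $Z$), ordered by $\supseteq$, with $\inf \mathcal A = \operatorname{cl}\operatorname{co}\bigcup_{A \in \mathcal A} A$ ($\inf \emptyset=\emptyset$). For $A \in \mathcal G(Z,C)$, $\sigma^{\vartriangle}_A \colon C^+ \to \mathbb R\cup\{\pm\infty\}$ is $\sigma^{\vartriangle}_A(z^* ) = \inf_{a \in A} z^*(a)$ (with $\inf \emptyset=+\infty$); the pointwise order is $\sigma \le \gamma$ iff $\sigma(z^* )\le\gamma(z^* )$ for all $z^*\in C^+$. $\mathcal B \subseteq\mathcal A$ generates the infimum of $\mathcal A$ if $\inf\mathcal B = \inf\mathcal A$. $\bar A \in \mathcal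 A$ is minimal for $\mathcal A$ if $A \in \mathcal A$, $A \supseteq \bar A$ imply $A = \bar A$. *)

theory Defs
  imports "HOL-Analysis.Analysis"
begin

text \<open>Locally convex spaces need not be Hausdorff here. Joint continuity of scalar
  multiplication is phrased in the style of the library axiom for addition. The constant
  \<open>convex\<close> is not available inside a class specification, so its definition is written out;
  \<open>convex_nhds_base\<close> below restates the axiom with it.\<close>

class locally_convex_space = real_vector + topological_ab_group_add +
  assumes tendsto_scaleR_Pair:
    "LIM x (nhds r \<times>\<^sub>F nhds a). fst x *\<^sub>R snd x :> nhds (r *\<^sub>R a)"
  and convex_nhds_base_raw:
    "open U \<Longrightarrow> 0 \<in> U \<Longrightarrow>
      \<exists>V. open V \<and>
        (\<forall>x\<in>V. \<forall>y\<in>V. \<forall>u\<ge>0. \<forall>v\<ge>0. u + v = 1 \<longrightarrow> u *\<^sub>R x + v *\<^sub>R y \<in> V) \<and>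
        0 \<in> V \<and> V \<subseteq> U"

lemma convex_nhds_base:
  fixes U :: "'z::locally_convex_space set"
  assumes "open U" "0 \<in> U"
  shows "\<exists>V. open V \<and> convex V \<and> 0 \<in> V \<and> V \<subseteq> U"
  using convex_nhds_base_raw[OF assms] unfolding convex_def .

instance real_normed_vector \<subseteq> locally_convex_space
proof
  fix r :: real and a :: 'a
  show "LIM x (nhds r \<times>\<^sub>F nhds a). fst x *\<^sub>R snd x :> nhds (r *\<^sub>R a)"
    using tendsto_fst[OF filterlim_ident, of "(r, a)"] tendsto_snd[OF filterlim_ident, of "(r, a)"]
    unfolding nhds_prod[symmetric] by (intro tendsto_scaleR) auto
next
  fix U :: "'a set"
  assume "open U" "0 \<in> U"
  then obtain e where "e > 0" "ball 0 e \<subseteq> U"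
    by (auto simp: open_contains_ball)
  then have "\<exists>V. open V \<and> convex V \<and> 0 \<in> V \<and> V \<subseteq> U"
    by (intro exI[of _ "ball 0 e"]) auto
  then show "\<exists>V. open V \<and>
      (\<forall>x\<in>V. \<forall>y\<in>V. \<forall>u\<ge>0. \<forall>v\<ge>0. u + v = 1 \<longrightarrow> u *\<^sub>R x + v *\<^sub>R y \<in> V) \<and>
      0 \<in> V \<and> V \<subseteq> U"
    unfolding convex_def .
qed

definition topological_dual :: "('z::locally_convex_space \<Rightarrow> real) set" where
  "topological_dual = {f. linear f \<and> continuous_on UNIV f}"

definition dual_cone :: "'z::locally_convex_space set \<Rightarrow> ('z \<Rightarrow> real) set" where
  "dual_cone C = {f \<in> topological_dual. \<forall>z\<in>C. 0 \<le> f z}"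

text \<open>The sum \<open>A + C\<close> is the Minkowski sum, with \<open>{} + C = {}\<close>.\<close>

definition closed_convex_sets :: "'z::locally_convex_space set \<Rightarrow> 'z set set" where
  "closed_convex_sets C = {A. A = closure (convex hull (A + C))}"

definition set_inf :: "'z::locally_convex_space set set \<Rightarrow> 'z set" where
  "set_inf \<A> = closure (convex hull (\<Union>\<A>))"

definition generates_inf :: "'z::locally_convex_space set set \<Rightarrow> 'z set set \<Rightarrow> bool" where
  "generates_inf \<B> \<A> \<longleftrightarrow> \<B> \<subseteq> \<A> \<and> set_inf \<B> = set_inf \<A>"

text \<open>Functions on \<open>dual_cone C\<close> are extensional (\<open>undefined\<close> outside), so that HOL equality
  of support functions is equality as functions on \<open>dual_cone C\<close>.\<close>

definition support_fun ::
    "'z::locally_convex_space set \<Rightarrow> 'z set \<Rightarrow> ('z \<Rightarrow> real) \<Rightarrow> ereal" where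
  "support_fun C A = (\<lambda>f\<in>dual_cone C. INF a\<in>A. ereal (f a))"

definition pointwise_le ::
    "'z::locally_convex_space set \<Rightarrow> (('z \<Rightarrow> real) \<Rightarrow> ereal) \<Rightarrow> (('z \<Rightarrow> real) \<Rightarrow> ereal) \<Rightarrow> bool" where
  "pointwise_le C \<sigma> \<gamma> \<longleftrightarrow> (\<forall>f\<in>dual_cone C. \<sigma> f \<le> \<gamma> f)"

definition minimal_in :: "('a \<Rightarrow> 'a \<Rightarrow> bool) \<Rightarrow> 'a set \<Rightarrow> 'a \<Rightarrow> bool" where
  "minimal_in le S x \<longleftrightarrow> x \<in> S \<and> (\<forall>y\<in>S. le y x \<longrightarrow> y = x)"

end

theory Submission
  imports Defs
begin

text \<open>Everything reduces to order reflection: for closed convex \<open>B\<close> with \<open>B + C \<subseteq> B\<close>,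
  \<open>A \<subseteq> B\<close> holds as soon as the support function of \<open>B\<close> lies below that of \<open>A\<close>. If some
  \<open>a \<in> A\<close> were outside \<open>B \<noteq> {}\<close>, a continuous functional \<open>f\<close> would satisfy
  \<open>f a + 1 \<le> f b\<close> on \<open>B\<close>, and \<open>B + C \<subseteq> B\<close> forces \<open>f\<close> into the dual cone; for \<open>B = {}\<close> the zero
  functional distinguishes \<open>A\<close> from \<open>B\<close>. The separation rests on a Mazur-Orlicz form of the
  Hahn-Banach theorem, proved by applying Zorn's lemma to sublinear functionals: the minimal
  ones are linear.\<close>

section \<open>Sublinear functionals\<close>

definition sublinear :: "('a::real_vector \<Rightarrow> real) \<Rightarrow> bool" where
  "sublinear p \<longleftrightarrow>
    (\<forall>x y. p (x + y) \<le> p x + p y) \<and> (\<forall>t\<ge>0. \<forall>x. p (t *\<^sub>R x) = t * p x)"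

text \<open>The inequality for \<open>t\<close> suffices, since the one for \<open>inverse t\<close>
  at \<open>t *\<^sub>R x\<close> is its converse.\<close>

lemma sublinearI:
  assumes "\<And>x y. p (x + y) \<le> p x + p y" and "p 0 = 0"
    and "\<And>t x. t > 0 \<Longrightarrow> p (t *\<^sub>R x) \<le> t * p x"
  shows "sublinear p"
proof -
  have "p (t *\<^sub>R x) = t * p x" if "t > 0" for t x
  proof (rule antisym)
    show "p (t *\<^sub>R x) \<le> t * p x" by (rule assms(3)[OF that])
    have "p x \<le> inverse t * p (t *\<^sub>R x)"
      using assms(3)[of "inverse t" "t *\<^sub>R x"] that by simp
    then show "t * p x \<le> p (t *\<^sub>R x)" using that by (simp add: field_simps)
  qed
  then have "p (t *\<^sub>R x) = t * p x" if "t \<ge> 0" for t x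
    using that assms(2) by (cases "t = 0") auto
  then show ?thesis unfolding sublinear_def using assms(1) by blast
qed

lemma sublinear_add: "sublinear p \<Longrightarrow> p (x + y) \<le> p x + p y"
  and sublinear_scaleR: "sublinear p \<Longrightarrow> t \<ge> 0 \<Longrightarrow> p (t *\<^sub>R x) = t * p x"
  by (auto simp: sublinear_def)

lemma sublinear_zero: "sublinear p \<Longrightarrow> p 0 = 0"
  using sublinear_scaleR[of p 0 0] by simp

lemma sublinear_ge_minus: "sublinear p \<Longrightarrow> - p (- x) \<le> p x"
  using sublinear_add[of p x "- x"] sublinear_zero[of p] by simp

text \<open>Once \<open>p (- x) = - p x\<close>, subadditivity at \<open>- x\<close> and
  \<open>- y\<close> is superadditivity at \<open>x\<close> and \<open>y\<close>, and homogeneity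
  extends to negative scalars.\<close>

lemma sublinear_odd_imp_linear:
  assumes p: "sublinear p" and odd: "\<And>x. p (- x) \<le> - p x"
  shows "linear p"
proof (rule linearI)
  have minus: "p (- x) = - p x" for x
    using odd[of x] sublinear_ge_minus[OF p, of x] by linarith
  show "p (x + y) = p x + p y" for x y
    using sublinear_add[OF p, of x y] sublinear_add[OF p, of "- x" "- y"]
      minus[of "x + y"] by (simp add: minus)
  show "p (t *\<^sub>R x) = t *\<^sub>R p x" for t x
    using sublinear_scaleR[OF p, of t x] sublinear_scaleR[OF p, of "- t" x] minus[of "t *\<^sub>R x"]
    by (cases "t \<ge> 0") auto
qed

section \<open>The Hahn-Banach theorem in Mazur-Orlicz form\<close>

text \<open>Here \<open>p\<close> is lowered along \<open>K\<close>, to the infimum of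
  \<open>p (x + s *\<^sub>R k) - s * c\<close> over \<open>s \<ge> 0\<close> and
  \<open>k \<in> K\<close>. The conclusion is an upper bound at \<open>- k\<close>, so it passes to
  every functional below \<open>q\<close>.\<close>

lemma sublinear_lower_on_convex:
  fixes K :: "'a::real_vector set"
  assumes p: "sublinear p" and K: "convex K" "K \<noteq> {}" and c: "\<And>k. k \<in> K \<Longrightarrow> c \<le> p k"
  shows "\<exists>q. sublinear q \<and> q \<le> p \<and> (\<forall>k\<in>K. q (- k) \<le> - c)"
proof -
  define G where "G x = (\<lambda>(s, k). p (x + s *\<^sub>R k) - s * c) ` ({0..} \<times> K)" for x
  define q where "q x = Inf (G x)" for x
  \<comment> \<open>This is where \<open>c \<le> p k\<close> enters: it keeps the infimum
    finite.\<close>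
  have G_ge: "- p (- x) \<le> g" if "g \<in> G x" for g x
  proof -
    from that obtain s k where s: "s \<ge> 0" "k \<in> K" and g: "g = p (x + s *\<^sub>R k) - s * c"
      by (auto simp: G_def)
    have "s * p k \<le> p (x + s *\<^sub>R k) + p (- x)"
      using sublinear_add[OF p, of "x + s *\<^sub>R k" "- x"] sublinear_scaleR[OF p s(1), of k] by simp
    moreover have "s * c \<le> s * p k" using s c by (intro mult_left_mono) auto
    ultimately show ?thesis by (simp add: g)
  qed
  have bdd: "bdd_below (G x)" for x
    using G_ge by (rule bdd_belowI)
  have ne: "G x \<noteq> {}" for x
    using K(2) by (auto simp: G_def)
  have q_le: "q x \<le> p (x + s *\<^sub>R k) - s * c" if "s \<ge> 0" "k \<in> K" for x s k
    unfolding q_def by (rule cInf_lower[OF _ bdd]) (use that in \<open>force simp: G_def\<close>)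
  obtain k0 where k0: "k0 \<in> K" using K(2) by blast
  have q_le_p: "q x \<le> p x" for x
    using q_le[of 0 k0 x] k0 by simp
  have "sublinear q"
  proof (rule sublinearI)
    fix x y
    have "q (x + y) \<le> g + h" if "g \<in> G x" "h \<in> G y" for g h
    proof -
      from that obtain s k t l where s: "s \<ge> 0" "k \<in> K" and g: "g = p (x + s *\<^sub>R k) - s * c"
        and t: "t \<ge> 0" "l \<in> K" and h: "h = p (y + t *\<^sub>R l) - t * c"
        by (auto simp: G_def)
      \<comment> \<open>Convexity of \<open>K\<close> merges the two directions into a multiple of
        one point \<open>m\<close>. If \<open>s + t = 0\<close>, both sides vanish and any point of
        \<open>K\<close> will do.\<close>
      obtain m where m: "m \<in> K" "(s + t) *\<^sub>R m = s *\<^sub>R k + t *\<^sub>R l"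
      proof (cases "s + t = 0")
        case True
        then show ?thesis using s t that[of k] by (simp add: add_nonneg_eq_0_iff)
      next
        case False
        let ?m = "(s / (s + t)) *\<^sub>R k + (t / (s + t)) *\<^sub>R l"
        have "?m \<in> K"
          using False s t by (intro convexD[OF K(1)]) (auto simp: add_divide_distrib[symmetric])
        then show ?thesis using False by (intro that[of ?m]) (simp_all add: scaleR_right_distrib)
      qed
      have "q (x + y) \<le> p ((x + s *\<^sub>R k) + (y + t *\<^sub>R l)) - (s + t) * c"
        using q_le[of "s + t" m "x + y"] s t m by (simp add: algebra_simps)
      then show ?thesis
        using sublinear_add[OF p, of "x + s *\<^sub>R k" "y + t *\<^sub>R l"]
        by (simp add: g h algebra_simps)
    qed
    then have "q (x + y) - h \<le> q x" if "h \<in> G y" for h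
      unfolding q_def[of x] using ne that by (intro cInf_greatest) (auto simp: algebra_simps)
    then have "q (x + y) - q x \<le> q y"
      unfolding q_def[of y] using ne by (intro cInf_greatest) (auto simp: algebra_simps)
    then show "q (x + y) \<le> q x + q y" by simp
  next
    show "q 0 = 0"
    proof (rule antisym)
      show "q 0 \<le> 0" using q_le_p[of 0] sublinear_zero[OF p] by simp
      show "0 \<le> q 0"
        unfolding q_def using ne G_ge[of _ 0] sublinear_zero[OF p]
        by (intro cInf_greatest) auto
    qed
  next
    fix t :: real and x assume t: "t > 0"
    have "q (t *\<^sub>R x) / t \<le> g" if "g \<in> G x" for g
    proof -
      from that obtain s k where s: "s \<ge> 0" "k \<in> K" and g: "g = p (x + s *\<^sub>R k) - s * c"
        by (auto simp: G_def)
      have "q (t *\<^sub>R x) \<le> p (t *\<^sub>R (x + s *\<^sub>R k)) - t * s * c"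
        using q_le[of "t * s" k "t *\<^sub>R x"] s t by (simp add: scaleR_right_distrib)
      also have "\<dots> = t * g"
        using t by (simp add: sublinear_scaleR[OF p] g right_diff_distrib)
      finally show ?thesis using t by (simp add: field_simps)
    qed
    then have "q (t *\<^sub>R x) / t \<le> q x"
      unfolding q_def[of x] using ne by (intro cInf_greatest) auto
    then show "q (t *\<^sub>R x) \<le> t * q x" using t by (simp add: field_simps)
  qed
  \<comment> \<open>With \<open>s = 1\<close> and the same \<open>k\<close>, the expression under
    the infimum is \<open>p 0 - c\<close>.\<close>
  moreover have "q (- k) \<le> - c" if "k \<in> K" for k
    using q_le[of 1 k "- k"] that sublinear_zero[OF p] by simp
  ultimately show ?thesis using q_le_p by (auto simp: le_fun_def)
qed

text \<open>The pointwise infimum works. It is finite because all members satisfy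
  \<open>- p (- x) \<le> q x\<close>, and subadditive because any two members of the chain have one
  of them below both.\<close>

lemma sublinear_chain_lower_bound:
  fixes Q :: "('a::real_vector \<Rightarrow> real) set"
  assumes "Q \<noteq> {}" and sub: "\<And>q. q \<in> Q \<Longrightarrow> sublinear q" and le: "\<And>q. q \<in> Q \<Longrightarrow> q \<le> p"
    and chain: "\<And>q r. q \<in> Q \<Longrightarrow> r \<in> Q \<Longrightarrow> q \<le> r \<or> r \<le> q"
  shows "\<exists>u. sublinear u \<and> (\<forall>q\<in>Q. u \<le> q)"
proof -
  define u where "u x = (INF q\<in>Q. q x)" for x
  have ge: "- p (- x) \<le> q x" if "q \<in> Q" for q x
    using sublinear_ge_minus[OF sub[OF that], of x] le[OF that] le_funD[of q p "- x"] by simp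
  then have bdd: "bdd_below ((\<lambda>q. q x) ` Q)" for x
    by (intro bdd_belowI2[of Q "- p (- x)"])
  have u_le: "u x \<le> q x" if "q \<in> Q" for q x
    unfolding u_def using bdd that by (rule cINF_lower)
  have u_ge: "l \<le> u x" if "\<And>q. q \<in> Q \<Longrightarrow> l \<le> q x" for l x
    unfolding u_def using assms(1) that by (rule cINF_greatest)
  have "sublinear u"
  proof (rule sublinearI)
    fix x y
    have "u (x + y) \<le> q x + r y" if "q \<in> Q" "r \<in> Q" for q r
    proof -
      obtain m where m: "m \<in> Q" "m \<le> q" "m \<le> r" using chain[of q r] \<open>q \<in> Q\<close> \<open>r \<in> Q\<close> by auto
      show ?thesis
        using u_le[OF m(1), of "x + y"] sublinear_add[OF sub[OF m(1)], of x y]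
          le_funD[OF m(2), of x] le_funD[OF m(3), of y] by linarith
    qed
    then have "u (x + y) - r y \<le> u x" if "r \<in> Q" for r
      using that by (intro u_ge) (simp add: algebra_simps)
    then have "u (x + y) - u x \<le> u y"
      by (intro u_ge) (simp add: algebra_simps)
    then show "u (x + y) \<le> u x + u y" by simp
  next
    show "u 0 = 0"
    proof -
      have "(\<lambda>q. q 0) ` Q = {0}"
        using sublinear_zero[OF sub] assms(1) by force
      then show ?thesis by (simp add: u_def)
    qed
  next
    fix t :: real and x assume t: "t > 0"
    have "u (t *\<^sub>R x) / t \<le> q x" if "q \<in> Q" for q
      using u_le[OF that, of "t *\<^sub>R x"] sublinear_scaleR[OF sub[OF that], of t x] t
      by (simp add: field_simps)
    then have "u (t *\<^sub>R x) / t \<le> u x" by (rule u_ge)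
    then show "u (t *\<^sub>R x) \<le> t * u x" using t by (simp add: field_simps)
  qed
  then show ?thesis using u_le by (auto simp: le_fun_def)
qed

text \<open>A minimal sublinear functional below the lowered \<open>q\<close> is linear, and for a
  linear \<open>f\<close> the inherited bound \<open>f (- k) \<le> - c\<close> reads
  \<open>c \<le> f k\<close>.\<close>

theorem mazur_orlicz:
  fixes K :: "'a::real_vector set"
  assumes p: "sublinear p" and K: "convex K" "K \<noteq> {}" and c: "\<And>k. k \<in> K \<Longrightarrow> c \<le> p k"
  shows "\<exists>f. linear f \<and> f \<le> p \<and> (\<forall>k\<in>K. c \<le> f k)"
proof -
  obtain q where q: "sublinear q" "q \<le> p" "\<And>k. k \<in> K \<Longrightarrow> q (- k) \<le> - c"
    using sublinear_lower_on_convex[OF assms] by blast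
  let ?S = "{r. sublinear r \<and> r \<le> q}"
  have "\<exists>m\<in>?S. \<forall>r\<in>?S. r \<le> m \<longrightarrow> r = m"
  proof (rule predicate_Zorn)
    \<comment> \<open>The order is reversed, so the maximal element from Zorn's lemma is minimal for
      \<open>\<le>\<close>.\<close>
    show "partial_order_on ?S (relation_of (\<lambda>r s. s \<le> r) ?S)"
      by (rule partial_order_on_relation_ofI) auto
    fix Q assume "Q \<in> Chains (relation_of (\<lambda>r s. s \<le> r) ?S)"
    then have Q: "Q \<subseteq> ?S" and chain: "\<And>r s. r \<in> Q \<Longrightarrow> s \<in> Q \<Longrightarrow> r \<le> s \<or> s \<le> r"
      by (auto simp: Chains_def relation_of_def)
    show "\<exists>u\<in>?S. \<forall>r\<in>Q. u \<le> r"
    proof (cases "Q = {}")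
      case True
      then show ?thesis using q(1) by auto
    next
      case False
      then obtain u where u: "sublinear u" "\<forall>r\<in>Q. u \<le> r"
        using sublinear_chain_lower_bound[of Q q] Q chain by blast
      obtain r where "r \<in> Q" using False by blast
      then have "u \<le> q" using u(2) Q by (blast intro: order_trans)
      then show ?thesis using u by blast
    qed
  qed
  then obtain f where f: "sublinear f" "f \<le> q"
    and min: "\<And>r. sublinear r \<Longrightarrow> r \<le> q \<Longrightarrow> r \<le> f \<Longrightarrow> r = f" by blast
  have "linear f"
  proof (rule sublinear_odd_imp_linear[OF f(1)])
    fix x
    \<comment> \<open>Lowering \<open>f\<close> along the singleton \<open>{x}\<close> with
      \<open>c = f x\<close> cannot change \<open>f\<close>, by minimality; so \<open>f\<close> is
      odd.\<close>
    obtain r where "sublinear r" "r \<le> f" "r (- x) \<le> - f x"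
      using sublinear_lower_on_convex[OF f(1), of "{x}" "f x"] by auto
    then show "f (- x) \<le> - f x" using min[of r] f(2) by (metis order_trans)
  qed
  moreover have "c \<le> f k" if "k \<in> K" for k
    using le_funD[OF f(2), of "- k"] q(3)[OF that] linear_neg[OF \<open>linear f\<close>, of k] by linarith
  ultimately show ?thesis using f(2) q(2) order_trans by blast
qed

section \<open>Minkowski functionals and separation in locally convex spaces\<close>

lemma tendsto_scaleR_lcs:
  fixes g :: "'b \<Rightarrow> 'z::locally_convex_space"
  assumes "(f \<longlongrightarrow> r) F" "(g \<longlongrightarrow> a) F"
  shows "((\<lambda>x. f x *\<^sub>R g x) \<longlongrightarrow> r *\<^sub>R a) F"
  using filterlim_compose[OF tendsto_scaleR_Pair filterlim_Pair[OF assms]] by simp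

lemma continuous_on_scaleR_lcs:
  fixes g :: "'b::topological_space \<Rightarrow> 'z::locally_convex_space"
  assumes "continuous_on S g"
  shows "continuous_on S (\<lambda>x. c *\<^sub>R g x)"
  using assms by (auto simp: continuous_on_def intro!: tendsto_scaleR_lcs)

text \<open>Neighbourhoods of 0 are absorbing, because \<open>x\<close> divided by
  \<open>n + 1\<close> tends to 0. This makes the infimum in the gauge run over a nonempty
  set.\<close>

lemma ex_inverse_scaleR_mem:
  fixes V :: "'z::locally_convex_space set"
  assumes "open V" "0 \<in> V"
  shows "\<exists>s>0. inverse s *\<^sub>R x \<in> V"
proof -
  have "((\<lambda>n. inverse (real (Suc n)) *\<^sub>R x) \<longlongrightarrow> 0 *\<^sub>R x) sequentially"
    by (intro tendsto_scaleR_lcs LIMSEQ_inverse_real_of_nat tendsto_const)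
  then have "\<forall>\<^sub>F n in sequentially. inverse (real (Suc n)) *\<^sub>R x \<in> V"
    using topological_tendstoD[of _ "0 *\<^sub>R x" sequentially V] assms by simp
  then obtain n where "inverse (real (Suc n)) *\<^sub>R x \<in> V"
    by (auto simp: eventually_sequentially)
  then show ?thesis by (intro exI[of _ "real (Suc n)"]) auto
qed

text \<open>The Minkowski functional of \<open>V\<close>.\<close>

definition gauge_functional :: "'z::real_vector set \<Rightarrow> 'z \<Rightarrow> real" where
  "gauge_functional V x = Inf {s. s > 0 \<and> inverse s *\<^sub>R x \<in> V}"

lemma gauge_functional_le:
  "s > 0 \<Longrightarrow> inverse s *\<^sub>R x \<in> V \<Longrightarrow> gauge_functional V x \<le> s"
  unfolding gauge_functional_def by (rule cInf_lower) (auto intro!: bdd_belowI[of _ 0])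

lemma gauge_functional_ge:
  fixes V :: "'z::locally_convex_space set"
  assumes "open V" "0 \<in> V" and "\<And>s. s > 0 \<Longrightarrow> inverse s *\<^sub>R x \<in> V \<Longrightarrow> l \<le> s"
  shows "l \<le> gauge_functional V x"
  unfolding gauge_functional_def
  using ex_inverse_scaleR_mem[OF assms(1,2), of x] assms(3)
  by (intro cInf_greatest) auto

lemma sublinear_gauge_functional:
  fixes V :: "'z::locally_convex_space set"
  assumes V: "open V" "0 \<in> V" and "convex V"
  shows "sublinear (gauge_functional V)" (is "sublinear ?p")
proof (rule sublinearI)
  note ge = gauge_functional_ge[OF V]
  fix x y
  have "?p (x + y) \<le> s + t"
    if s: "s > 0" "inverse s *\<^sub>R x \<in> V" and t: "t > 0" "inverse t *\<^sub>R y \<in> V" for s t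
  proof (rule gauge_functional_le)
    \<comment> \<open>The weights are chosen so that both coefficients become
      \<open>inverse (s + t)\<close>.\<close>
    have "(s / (s + t)) *\<^sub>R (inverse s *\<^sub>R x) + (t / (s + t)) *\<^sub>R (inverse t *\<^sub>R y) \<in> V"
      using s t by (intro convexD[OF \<open>convex V\<close>]) (auto simp: add_divide_distrib[symmetric])
    moreover have "s / (s + t) * inverse s = inverse (s + t)"
      "t / (s + t) * inverse t = inverse (s + t)"
      using s(1) t(1) by (simp_all add: field_simps)
    ultimately show "inverse (s + t) *\<^sub>R (x + y) \<in> V"
      by (simp only: scaleR_scaleR scaleR_right_distrib)
  qed (use s t in simp)
  then have "?p (x + y) - t \<le> ?p x" if "t > 0" "inverse t *\<^sub>R y \<in> V" for t
    using that by (intro ge) (simp add: algebra_simps)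
  then have "?p (x + y) - ?p x \<le> ?p y"
    by (intro ge) (simp add: algebra_simps)
  then show "?p (x + y) \<le> ?p x + ?p y" by simp
next
  have "?p 0 \<le> 0"
    by (rule field_le_epsilon) (use V in \<open>auto intro: gauge_functional_le\<close>)
  moreover have "0 \<le> ?p 0" by (rule gauge_functional_ge[OF V]) simp
  ultimately show "?p 0 = 0" by simp
next
  fix t :: real and x assume t: "t > 0"
  have "?p (t *\<^sub>R x) / t \<le> ?p x"
  proof (rule gauge_functional_ge[OF V])
    fix s :: real assume "s > 0" "inverse s *\<^sub>R x \<in> V"
    then have "?p (t *\<^sub>R x) \<le> t * s"
      using t by (intro gauge_functional_le) (auto simp: field_simps)
    then show "?p (t *\<^sub>R x) / t \<le> s" using t by (simp add: field_simps)
  qed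
  then show "?p (t *\<^sub>R x) \<le> t * ?p x" using t by (simp add: field_simps)
qed

text \<open>An admissible \<open>s < 1\<close> would make \<open>x\<close> a convex combination of
  \<open>inverse s *\<^sub>R x\<close> and 0, both in \<open>V\<close>.\<close>

lemma gauge_functional_ge_1:
  fixes V :: "'z::locally_convex_space set"
  assumes "open V" "0 \<in> V" "convex V" "x \<notin> V"
  shows "1 \<le> gauge_functional V x"
proof (rule gauge_functional_ge[OF assms(1,2)], rule ccontr)
  fix s :: real assume s: "s > 0" "inverse s *\<^sub>R x \<in> V" "\<not> 1 \<le> s"
  then have "s *\<^sub>R (inverse s *\<^sub>R x) + (1 - s) *\<^sub>R 0 \<in> V"
    using assms(2) by (intro convexD[OF assms(3)]) auto
  then show False using s assms(4) by simp
qed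

lemma linear_le_1_on_nhds_imp_continuous:
  fixes V :: "'z::locally_convex_space set"
  assumes f: "linear f" and V: "open V" "0 \<in> V" and le: "\<And>v. v \<in> V \<Longrightarrow> f v \<le> (1::real)"
  shows "continuous_on UNIV f"
  unfolding continuous_on_def
proof (intro ballI tendstoI)
  fix x and e :: real assume e: "e > 0"
  \<comment> \<open>The bound on \<open>V\<close> is one-sided and \<open>V\<close> may be
    asymmetric, so both signs of the difference are required. The factor \<open>2 / e\<close> yields
    a distance of at most \<open>e / 2\<close>.\<close>
  define W where "W = {y. (2 / e) *\<^sub>R (y - x) \<in> V} \<inter> {y. (2 / e) *\<^sub>R (x - y) \<in> V}"
  have "open W"
    unfolding W_def
    by (intro open_Int open_vimage[unfolded vimage_def] continuous_on_scaleR_lcs continuous_intros V)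
  moreover have "x \<in> W" using V by (simp add: W_def)
  moreover have "dist (f y) (f x) < e" if "y \<in> W" for y
  proof -
    have "(2 / e) * (f y - f x) \<le> 1" "(2 / e) * (f x - f y) \<le> 1"
      using le[of "(2 / e) *\<^sub>R (y - x)"] le[of "(2 / e) *\<^sub>R (x - y)"] that
      by (simp_all add: W_def linear_scale[OF f] linear_diff[OF f])
    then show ?thesis using e by (simp add: dist_real_def field_simps abs_less_iff)
  qed
  ultimately show "\<forall>\<^sub>F y in at x. dist (f y) (f x) < e"
    by (auto simp: eventually_at_topological)
qed

text \<open>Choose a convex open \<open>V\<close> around 0 with \<open>a + V\<close> disjoint from
  \<open>B\<close>. Its gauge is at least 1 on \<open>B - a\<close>, so Mazur-Orlicz gives a linear
  \<open>f\<close> with gap 1; \<open>f\<close> is below the gauge, hence at most 1 on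
  \<open>V\<close>, hence continuous.\<close>

lemma separate_point_closed_convex:
  fixes B :: "'z::locally_convex_space set"
  assumes B: "closed B" "convex B" "B \<noteq> {}" and a: "a \<notin> B"
  shows "\<exists>f\<in>topological_dual. \<forall>b\<in>B. f a + 1 \<le> f b"
proof -
  have "open ((\<lambda>x. a + x) -` (- B))"
    using B(1) by (intro open_vimage continuous_intros) auto
  then obtain V where V: "open V" "convex V" "0 \<in> V" "V \<subseteq> (\<lambda>x. a + x) -` (- B)"
    using convex_nhds_base[of "(\<lambda>x. a + x) -` (- B)"] a by auto
  have "1 \<le> gauge_functional V k" if "k \<in> (\<lambda>b. b - a) ` B" for k
    using V that by (intro gauge_functional_ge_1) auto
  moreover have "convex ((\<lambda>b. b - a) ` B)"
    using convex_translation_subtract[OF B(2)] by simp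
  ultimately obtain f where f: "linear f" "f \<le> gauge_functional V"
    and sep: "\<And>k. k \<in> (\<lambda>b. b - a) ` B \<Longrightarrow> 1 \<le> f k"
    using mazur_orlicz[OF sublinear_gauge_functional[OF V(1,3,2)], of "(\<lambda>b. b - a) ` B" 1] B(3)
    by blast
  have "f v \<le> 1" if "v \<in> V" for v
    using le_funD[OF f(2), of v] gauge_functional_le[of 1 v V] that by simp
  then have "continuous_on UNIV f"
    by (rule linear_le_1_on_nhds_imp_continuous[OF f(1) V(1,3)])
  moreover have "f a + 1 \<le> f b" if "b \<in> B" for b
    using sep[of "b - a"] that by (simp add: linear_diff[OF f(1)])
  ultimately show ?thesis using f(1) unfolding topological_dual_def by blast
qed

section \<open>Closed convex sets and their infima\<close>

text \<open>The two points are moved into the closure one at a time, each by continuity of an affine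
  map of one variable.\<close>

lemma convex_closure_lcs:
  fixes S :: "'z::locally_convex_space set"
  assumes "convex S"
  shows "convex (closure S)"
proof (rule convexI)
  fix x y and u v :: real
  assume x: "x \<in> closure S" and y: "y \<in> closure S" and uv: "0 \<le> u" "0 \<le> v" "u + v = 1"
  have cont: "continuous_on T (\<lambda>z. u *\<^sub>R z + w)" "continuous_on T (\<lambda>z. w + v *\<^sub>R z)"
    for T and w :: 'z
    by (intro continuous_intros continuous_on_scaleR_lcs)+
  have "u *\<^sub>R s + v *\<^sub>R y \<in> closure S" if "s \<in> S" for s
  proof -
    have "(\<lambda>z. u *\<^sub>R s + v *\<^sub>R z) ` closure S \<subseteq> closure S"
      using convexD[OF assms that _ uv] closure_subset
      by (intro image_closure_subset cont) auto
    then show ?thesis using y by blast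
  qed
  then have "(\<lambda>z. u *\<^sub>R z + v *\<^sub>R y) ` closure S \<subseteq> closure S"
    by (intro image_closure_subset cont) auto
  then show "u *\<^sub>R x + v *\<^sub>R y \<in> closure S" using x by blast
qed

lemma closed_convex_setsD:
  assumes "A \<in> closed_convex_sets C"
  shows "closed A" "convex A" "\<And>a c. a \<in> A \<Longrightarrow> c \<in> C \<Longrightarrow> a + c \<in> A"
proof -
  have A: "A = closure (convex hull (A + C))"
    using assms by (simp add: closed_convex_sets_def)
  show "closed A" by (subst A) simp
  show "convex A" by (subst A) (intro convex_closure_lcs convex_convex_hull)
  fix a c assume "a \<in> A" "c \<in> C"
  then have "a + c \<in> A + C" by (rule set_plus_intro)
  then show "a + c \<in> A"
    using A hull_subset[of "A + C" convex] closure_subset by blast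
qed

lemma convex_set_inf: "convex (set_inf \<A>)"
  unfolding set_inf_def by (intro convex_closure_lcs convex_convex_hull)

text \<open>Translation by \<open>c\<close> commutes with convex hulls and is continuous, so
  invariance of the members passes to hull and closure.\<close>

lemma set_inf_add_mem:
  fixes \<A> :: "'z::locally_convex_space set set"
  assumes "\<And>A a. A \<in> \<A> \<Longrightarrow> a \<in> A \<Longrightarrow> a + c \<in> A" and x: "x \<in> set_inf \<A>"
  shows "x + c \<in> set_inf \<A>"
proof -
  have "(\<lambda>y. c + y) ` (convex hull \<Union>\<A>) = convex hull ((\<lambda>y. c + y) ` \<Union>\<A>)"
    by (rule convex_hull_translation[symmetric])
  also have "\<dots> \<subseteq> convex hull \<Union>\<A>"
    using assms(1) by (intro hull_mono) (force simp: add.commute)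
  finally have "(\<lambda>y. c + y) ` closure (convex hull \<Union>\<A>) \<subseteq> closure (convex hull \<Union>\<A>)"
    using closure_subset by (intro image_closure_subset continuous_intros) auto
  then show ?thesis using x by (auto simp: set_inf_def add.commute)
qed

section \<open>Order reflection by support functions\<close>

text \<open>The properties of \<open>B\<close> are listed separately so that the lemma applies to
  \<open>set_inf\<close> as well as to members of \<open>closed_convex_sets C\<close>.\<close>

lemma subset_if_support_fun_le:
  fixes B :: "'z::locally_convex_space set"
  assumes B: "closed B" "convex B" and BC: "\<And>b c. b \<in> B \<Longrightarrow> c \<in> C \<Longrightarrow> b + c \<in> B"
    and C: "convex_cone C"
    and le: "pointwise_le C (support_fun C B) (support_fun C A)"
  shows "A \<subseteq> B"
proof
  fix a assume a: "a \<in> A"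
  have le': "(INF b\<in>B. ereal (f b)) \<le> ereal (f a)" if "f \<in> dual_cone C" for f
  proof -
    have "(INF b\<in>B. ereal (f b)) \<le> (INF a\<in>A. ereal (f a))"
      using le that by (simp add: pointwise_le_def support_fun_def)
    also have "\<dots> \<le> ereal (f a)" using a by (rule INF_lower)
    finally show ?thesis .
  qed
  have "(\<lambda>_. 0) \<in> dual_cone C"
    by (auto simp: dual_cone_def topological_dual_def intro: linear_zero)
  \<comment> \<open>For empty \<open>B\<close> the infimum would be plus infinity, which is not
    below 0.\<close>
  from le'[OF this] have ne: "B \<noteq> {}" by (auto simp: top_ereal_def)
  show "a \<in> B"
  proof (rule ccontr)
    assume "a \<notin> B"
    then obtain f where f: "f \<in> topological_dual" and sep: "\<And>b. b \<in> B \<Longrightarrow> f a + 1 \<le> f b"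
      using separate_point_closed_convex[OF B ne] by blast
    have lin: "linear f" using f by (simp add: topological_dual_def)
    have "0 \<le> f c" if c: "c \<in> C" for c
    proof (rule ccontr)
      assume neg: "\<not> 0 \<le> f c"
      obtain b where b: "b \<in> B" using ne by blast
      \<comment> \<open>With this \<open>t\<close>, moving from \<open>b\<close> by
        \<open>t *\<^sub>R c\<close> brings the value of \<open>f\<close> down to exactly
        \<open>f a\<close>, against the gap of 1.\<close>
      define t where "t = (f b - f a) / (- f c)"
      have "t \<ge> 0" using sep[OF b] neg by (simp add: t_def field_simps)
      then have "t *\<^sub>R c \<in> C" using C c by (simp add: convex_cone_def conic_def)
      then have "f a + 1 \<le> f b + t * f c"
        using sep[OF BC[OF b], of "t *\<^sub>R c"] linear_add[OF lin] linear_scale[OF lin] by simp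
      moreover have "t * f c = f a - f b" using neg by (simp add: t_def field_simps)
      ultimately show False by simp
    qed
    then have "f \<in> dual_cone C" using f by (simp add: dual_cone_def)
    from le'[OF this] have "(INF b\<in>B. ereal (f b)) \<le> ereal (f a)" .
    moreover have "ereal (f a + 1) \<le> (INF b\<in>B. ereal (f b))"
      using sep by (intro INF_greatest) simp
    ultimately have "ereal (f a + 1) \<le> ereal (f a)" by (rule order_trans[rotated])
    then show False by simp
  qed
qed

lemma support_fun_antimono: "A \<subseteq> B \<Longrightarrow> pointwise_le C (support_fun C B) (support_fun C A)"
  by (auto simp: pointwise_le_def support_fun_def intro: INF_superset_mono)

lemma pointwise_le_refl: "pointwise_le C \<sigma> \<sigma>"
  by (simp add: pointwise_le_def)

theorem corollary4p18:
  fixes C :: "'z::locally_convex_space set"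
    and \<A> :: "'z set set"
  assumes nontrivial: "\<exists>z::'z. z \<noteq> 0"
    and cone: "convex_cone C" "0 \<in> C"
    and family: "\<A> \<subseteq> closed_convex_sets C"
  shows "(\<forall>\<B>. \<B> \<subseteq> \<A> \<longrightarrow>
            (generates_inf \<B> \<A> \<longleftrightarrow>
              support_fun C (set_inf \<B>) = support_fun C (set_inf \<A>))) \<and>
         (\<forall>A\<in>\<A>.
            (minimal_in (\<lambda>X Y. X \<supseteq> Y) \<A> A \<longleftrightarrow>
              minimal_in (pointwise_le C) (support_fun C ` \<A>) (support_fun C A)))"
proof (intro conjI allI impI ballI)
  fix \<B> assume sub: "\<B> \<subseteq> \<A>"
  \<comment> \<open>Taking \<open>\<D>\<close> to be \<A> and then \<B> gives the two inclusions
    between the infima.\<close>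
  have inf_sub: "X \<subseteq> set_inf \<D>"
    if "\<D> \<subseteq> \<A>" "support_fun C (set_inf \<D>) = support_fun C X" for X \<D>
  proof (rule subset_if_support_fun_le[OF _ convex_set_inf _ cone(1)])
    show "closed (set_inf \<D>)" by (simp add: set_inf_def)
    show "b + c \<in> set_inf \<D>" if "b \<in> set_inf \<D>" "c \<in> C" for b c
      by (rule set_inf_add_mem[OF _ that(1)])
        (use closed_convex_setsD(3) family \<open>\<D> \<subseteq> \<A>\<close> that(2) in blast)
    show "pointwise_le C (support_fun C (set_inf \<D>)) (support_fun C X)"
      using that(2) by (simp add: pointwise_le_refl)
  qed
  show "generates_inf \<B> \<A> \<longleftrightarrow> support_fun C (set_inf \<B>) = support_fun C (set_inf \<A>)"
    using inf_sub[of \<A> "set_inf \<B>"] inf_sub[of \<B> "set_inf \<A>"] sub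
    by (auto simp: generates_inf_def)
next
  fix A assume A: "A \<in> \<A>"
  \<comment> \<open>On \<A>, ordered by reverse inclusion, \<open>support_fun C\<close> is an order
    embedding, injective by antisymmetry of inclusion. Such a map preserves and reflects minimal
    elements.\<close>
  have le_iff: "pointwise_le C (support_fun C Y) (support_fun C X) \<longleftrightarrow> X \<subseteq> Y"
    if "Y \<in> \<A>" for X Y
    using subset_if_support_fun_le[of Y C X] closed_convex_setsD[of Y C] cone(1) family that
      support_fun_antimono[of X Y C] by blast
  have eq_iff: "support_fun C Y = support_fun C X \<longleftrightarrow> Y = X" if "X \<in> \<A>" "Y \<in> \<A>" for X Y
    using le_iff[of X Y] le_iff[of Y X] that pointwise_le_refl by (metis subset_antisym)
  show "minimal_in (\<lambda>X Y. X \<supseteq> Y) \<A> A \<longleftrightarrow>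
      minimal_in (pointwise_le C) (support_fun C ` \<A>) (support_fun C A)"
    using A le_iff eq_iff by (auto simp: minimal_in_def)
qed

end
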